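(* Let $\mathcal{B}$ be a basis of a real Banach space $\mathbb{X}$ and let $\lambda>1$. The following assertions are equivalent: (i) $\mathcal{B}$ is almost-greedy. (ii) There is a constant $C_\lambda>0$ such that $\|x-\mathcal{G}_{[\lambda m]}(x)\|\le C_\lambda\,\mathcal{D}_m(x)$ for every $x\in\mathbb{X}$ and every $m\in\mathbb{N}$. (iii) There is a constant $C_\lambda>0$ such that $\|x-\mathcal{G}_{[\lambda m]}(x)\|\le C_\lambda\,\mathcal{D}_m^*(x)$ for every $x\in\mathbb{X}$ and every $m\in\mathbb{N}$.
   Context: Let $(\mathbb{X},\|\cdot\|)$ be a real Banach space. A "basis" of $\mathbb{X}$ means a semi-normalized Schauder basis $\mathcal{B}=(e_n)_{n=1}^{\infty}$ with biorthogonal functionals $(e_n^* )_{n=1}^\infty\subset\mathbb{X}^*$, i.e.: (i) there exist $a,b>0$ with $a\le\|e_n\|,\|e_n^*\|\le b$ for all $n\in\mathbb{N}$; (ii) $e_k^*(e_n)=\delta_{kn}$ for all $k,n$; (iii) the projections $P_m(x)=\sum_{n=1}^m e_n^*(x)e_n$ satisfy $\lim_m\|P_m(x)-x\|=0$ for every $x\in\mathbb{X}$. For a finite set $A\subset\mathbb{N}$ and signs $\varepsilon=(\varepsilon_n)$ with $|\varepsilon_n|=1$ for all $n$ (written $|\varepsilon|=1$; here $\varepsilon_n\in\{\pm1\}$), put $\mathbf{1}_A=\sum_{n\in A}e_n$ and $\mathbf{1}_{\varepsilon A}=\sum_{n\in A}\varepsilon_n e_n$. Denote by $|A|$ the cardinality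 of $A$, and by $[t]$ the integer part of $t$. For $x\in\mathbb{X}$ and $m\in\mathbb{N}$ define $$\mathcal{D}_m(x)=\inf\{\|x-\alpha\mathbf{1}_A\|:\alpha\in\mathbb{R},\ A\subset\mathbb{N},\ |A|=m\},$$ $$\mathcal{D}_m^*(x)=\inf\{\|x-\alpha\mathbf{1}_{\varepsilon A}\|:\alpha\in\mathbb{R},\ A\subset\mathbb{N},\ |A|=m,\ |\varepsilon|=1\}.$$ Greedy sums: for $x\in\mathbb{X}$ let $\rho:\mathbb{N}\to\mathbb{N}$ be the rearranging function such that if $j<k$ then either $|e_{\rho(j)}^*(x)|>|e_{\rho(k)}^*(x)|$, or $|e_{\rho(j)}^*(x)|=|e_{\rho(k)}^*(x)|$ and $\rho(j)<\rho(k)$ (coefficients are taken in decreasing order of modulus, ties broken by smaller index). The $m$-th greedy sum is $\mathcal{G}_m(x)=\sum_{j=1}^m e_{\rho(j)}^*(x)e_{\rho(j)}$. The basis $\mathcal{B}$ is almost-greedy if there exists $C>0$ such that $\|x-\mathcal{G}_m(x)\|\le C\,\widetilde{\sigma}_m(x)$ for all $x\in\mathbb{X}$ and $m\in\mathbb{N}$, where $\widetilde{\sigma}_m(x)=\inf\{\|x-\sum_{n\in A}e_n^*(x)e_n\|:A\subset\mathbb{N},\ |A|=m\}$. *)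

theory Defs
  imports "HOL-Analysis.Analysis"
begin

text \<open>
  Basis vectors are indexed by \<^typ>\<open>nat\<close> starting at 0, so the first \<open>m\<close> indices are \<open>{..<m}\<close>.
  The functionals \<open>f n\<close> are bounded linear functionals, so their norm is the dual (operator) norm.
\<close>

definition is_basis :: "(nat \<Rightarrow> 'a::banach) \<Rightarrow> (nat \<Rightarrow> 'a \<Rightarrow>\<^sub>L real) \<Rightarrow> bool" where
  "is_basis e f \<longleftrightarrow>
     (\<exists>a>0. \<exists>b>0. \<forall>n. a \<le> norm (e n) \<and> norm (e n) \<le> b \<and> a \<le> norm (f n) \<and> norm (f n) \<le> b) \<and>
     (\<forall>k n. blinfun_apply (f k) (e n) = (if k = n then 1 else 0)) \<and>
     (\<forall>x. (\<lambda>m. norm ((\<Sum>n<m. blinfun_apply (f n) x *\<^sub>R e n) - x)) \<longlonglongrightarrow> 0)"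

definition indicator_sum :: "(nat \<Rightarrow> 'a::banach) \<Rightarrow> nat set \<Rightarrow> 'a" where
  "indicator_sum e A = (\<Sum>n\<in>A. e n)"

definition signed_indicator_sum :: "(nat \<Rightarrow> 'a::banach) \<Rightarrow> (nat \<Rightarrow> real) \<Rightarrow> nat set \<Rightarrow> 'a" where
  "signed_indicator_sum e \<epsilon> A = (\<Sum>n\<in>A. \<epsilon> n *\<^sub>R e n)"

definition D_err :: "(nat \<Rightarrow> 'a::banach) \<Rightarrow> nat \<Rightarrow> 'a \<Rightarrow> real" where
  "D_err e m x = Inf {norm (x - \<alpha> *\<^sub>R indicator_sum e A) | \<alpha> A. finite A \<and> card A = m}"

definition D_star_err :: "(nat \<Rightarrow> 'a::banach) \<Rightarrow> nat \<Rightarrow> 'a \<Rightarrow> real" where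
  "D_star_err e m x =
     Inf {norm (x - \<alpha> *\<^sub>R signed_indicator_sum e \<epsilon> A) | \<alpha> A \<epsilon>.
            finite A \<and> card A = m \<and> (\<forall>n. \<bar>\<epsilon> n\<bar> = 1)}"

definition sigma_tilde ::
  "(nat \<Rightarrow> 'a::banach) \<Rightarrow> (nat \<Rightarrow> 'a \<Rightarrow>\<^sub>L real) \<Rightarrow> nat \<Rightarrow> 'a \<Rightarrow> real" where
  "sigma_tilde e f m x =
     Inf {norm (x - (\<Sum>n\<in>A. blinfun_apply (f n) x *\<^sub>R e n)) | A. finite A \<and> card A = m}"

text \<open>
  The ordering clause alone would also be satisfied by maps that skip nonzero coefficients;
  that \<open>\<rho>\<close> rearranges the coefficients of \<open>x\<close> means that its range contains the support of \<open>x\<close>.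
  A bijection cannot be required: if \<open>x\<close> has infinite support, indices with zero coefficient
  are never reached.
\<close>

definition greedy_ordering :: "(nat \<Rightarrow> 'a::banach \<Rightarrow>\<^sub>L real) \<Rightarrow> 'a \<Rightarrow> (nat \<Rightarrow> nat) \<Rightarrow> bool" where
  "greedy_ordering f x \<rho> \<longleftrightarrow>
     {n. blinfun_apply (f n) x \<noteq> 0} \<subseteq> range \<rho> \<and>
     (\<forall>j k. j < k \<longrightarrow>
        \<bar>blinfun_apply (f (\<rho> j)) x\<bar> > \<bar>blinfun_apply (f (\<rho> k)) x\<bar> \<or>
        (\<bar>blinfun_apply (f (\<rho> j)) x\<bar> = \<bar>blinfun_apply (f (\<rho> k)) x\<bar> \<and> \<rho> j < \<rho> k))"

text \<open>
  For a basis the coefficients of \<open>x\<close> tend to 0, so a greedy ordering exists. Two greedy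
  orderings of the same \<open>x\<close> can differ only where the coefficients vanish, so the value below
  does not depend on the choice.
\<close>

definition greedy_sum ::
  "(nat \<Rightarrow> 'a::banach) \<Rightarrow> (nat \<Rightarrow> 'a \<Rightarrow>\<^sub>L real) \<Rightarrow> nat \<Rightarrow> 'a \<Rightarrow> 'a" where
  "greedy_sum e f m x =
     (let \<rho> = (SOME \<rho>. greedy_ordering f x \<rho>)
      in \<Sum>j<m. blinfun_apply (f (\<rho> j)) x *\<^sub>R e (\<rho> j))"

definition almost_greedy :: "(nat \<Rightarrow> 'a::banach) \<Rightarrow> (nat \<Rightarrow> 'a \<Rightarrow>\<^sub>L real) \<Rightarrow> bool" where
  "almost_greedy e f \<longleftrightarrow>
     (\<exists>C>0. \<forall>x. \<forall>m\<ge>1. norm (x - greedy_sum e f m x) \<le> C * sigma_tilde e f m x)"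

end

theory Submission
  imports Defs
begin

text \<open>
  The three assertions are linked through a fourth one: the basis is quasi-greedy (removing a
  greedy set from \<open>x\<close> multiplies the norm by at most a constant) and superdemocratic
  (a signed sum is dominated, up to a constant, by every signed sum over a disjoint set that is at
  least as large). Everything is phrased with greedy sets, that is, finite sets on which the coefficients
  of \<open>x\<close> are at least as large as off the set. A small perturbation makes the
  inequalities between these coefficients strict, and then the greedy sum has no choice; so a bound for greedy sums is a bound
  for all greedy sets (\<open>greedy_set_bound_of_greedy_sum_bound\<close>).

  Almost-greediness yields both properties by competing against well-chosen sets: a set far out,
  where \<open>x\<close> is almost zero, for quasi-greediness, and \<open>B\<close> itself for the vector
  \<open>1\<^bsub>\<epsilon>A\<^esub> + 1\<^bsub>\<eta>B\<^esub>\<close>, of which \<open>A\<close> is a greedy set, for superdemocracy.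

  Conversely, the workhorse is \<open>small_coefficients_bound\<close>: if the coefficients of
  \<open>z\<close> are at least \<open>t\<close> on a greedy set \<open>G\<close>, then a combination with
  coefficients at most \<open>t\<close>, on a set of size at most \<open>k\<close> times that of a disjoint part
  of \<open>G\<close>, has norm at most a constant times \<open>k \<parallel>z\<parallel>\<close>. Given
  \<open>x\<close>, a greedy set \<open>A\<close> of \<open>[\<lambda>m]\<close> indices and any \<open>y\<close> supported on a set
  \<open>B\<close> of \<open>m\<close> indices, put \<open>z = x - y\<close>. Off \<open>B\<close> the vectors
  \<open>z\<close> and \<open>x\<close> have the same coefficients, so \<open>x - P\<^sub>A x\<close> differs from the greedy
  remainder of \<open>z\<close> by two combinations on subsets of \<open>B\<close> with coefficients at most the
  threshold of \<open>A\<close>. Since \<open>\<lambda> > 1\<close>, the set \<open>A - B\<close> contains a fixed proportion of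
  \<open>m\<close> indices (apart from the case \<open>A = B\<close>, which bounds \<open>m\<close>), and the
  workhorse applies. This is stronger than assertion (iii), as \<open>y\<close> may have arbitrary
  coefficients. Since \<open>D\<^sub>m\<^sup>* \<le> D\<^sub>m\<close>, (iii) implies (ii).

  Finally, (ii) with \<open>\<alpha> = 0\<close> gives quasi-greediness along the sizes \<open>[\<lambda>m]\<close>,
  whose gaps are bounded. With \<open>\<alpha> = 1\<close> it compares sums over \<open>m\<close> indices with sums
  over \<open>[\<lambda>m]\<close> indices, and superdemocracy follows because a set of size
  \<open>[\<lambda>m]\<close> splits into boundedly many sets of size \<open>m\<close>.
\<close>

section \<open>Coordinate projections and greedy sets\<close>

locale schauder_basis =
  fixes e :: "nat \<Rightarrow> 'a::banach" and f :: "nat \<Rightarrow> 'a \<Rightarrow>\<^sub>L real"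
  assumes basis: "is_basis e f"
begin

definition proj :: "nat set \<Rightarrow> 'a \<Rightarrow> 'a" where
  "proj A x = (\<Sum>n\<in>A. f n x *\<^sub>R e n)"

definition greedy_set :: "'a \<Rightarrow> nat set \<Rightarrow> bool" where
  "greedy_set x A \<longleftrightarrow> finite A \<and> (\<forall>n\<in>A. \<forall>k. k \<notin> A \<longrightarrow> \<bar>f k x\<bar> \<le> \<bar>f n x\<bar>)"

definition quasi_greedy_with :: "real \<Rightarrow> bool" where
  "quasi_greedy_with K \<longleftrightarrow> (\<forall>x A. greedy_set x A \<longrightarrow> norm (x - proj A x) \<le> K * norm x)"

definition superdemocratic_with :: "real \<Rightarrow> bool" where
  "superdemocratic_with C \<longleftrightarrow>
     (\<forall>A B \<epsilon> \<eta>. finite A \<and> finite B \<and> A \<inter> B = {} \<and> card B \<le> card A \<and>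
        (\<forall>n. \<bar>\<epsilon> n\<bar> = 1) \<and> (\<forall>n. \<bar>\<eta> n\<bar> = 1) \<longrightarrow>
        norm (signed_indicator_sum e \<eta> B) \<le> C * norm (signed_indicator_sum e \<epsilon> A))"

lemma f_e: "f k (e n) = (if k = n then 1 else 0)"
  using basis by (simp add: is_basis_def)

lemma f_combination:
  assumes "finite A"
  shows "f k (\<Sum>n\<in>A. a n *\<^sub>R e n) = (if k \<in> A then a k else 0)"
proof -
  have "f k (\<Sum>n\<in>A. a n *\<^sub>R e n) = (\<Sum>n\<in>A. if k = n then a n else 0)"
    unfolding blinfun.sum_right blinfun.scaleR_right f_e by (rule sum.cong) auto
  then show ?thesis using assms by simp
qed

lemma proj_combination:
  assumes "finite B" "finite A"
  shows "proj A (\<Sum>n\<in>B. a n *\<^sub>R e n) = (\<Sum>n\<in>A \<inter> B. a n *\<^sub>R e n)"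
proof -
  have "proj A (\<Sum>n\<in>B. a n *\<^sub>R e n) = (\<Sum>n\<in>A. if n \<in> B then a n *\<^sub>R e n else 0)"
    unfolding proj_def f_combination[OF assms(1)] by (rule sum.cong) auto
  then show ?thesis using assms(2) by (simp add: sum.inter_restrict)
qed

lemma proj_empty [simp]: "proj {} x = 0"
  by (simp add: proj_def)

lemma proj_diff: "proj A (x - y) = proj A x - proj A y"
  by (simp add: proj_def blinfun.diff_right scaleR_left_diff_distrib sum_subtractf)

lemma proj_Un:
  assumes "finite A" "finite B" "A \<inter> B = {}"
  shows "proj (A \<union> B) x = proj A x + proj B x"
  unfolding proj_def by (rule sum.union_disjoint[OF assms])

lemma f_proj:
  assumes "finite A"
  shows "f k (proj A x) = (if k \<in> A then f k x else 0)"
  unfolding proj_def by (rule f_combination[OF assms])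

lemma basis_bound:
  obtains b where "b > 0" "\<And>n. norm (e n) \<le> b" "\<And>n x. \<bar>f n x\<bar> \<le> b * norm x"
proof -
  obtain b where b: "b > 0" "\<And>n. norm (e n) \<le> b" "\<And>n. norm (f n) \<le> b"
    using basis unfolding is_basis_def by blast
  have "\<bar>f n x\<bar> \<le> b * norm x" for n x
    using norm_blinfun[of "f n" x] mult_right_mono[OF b(3)[of n] norm_ge_zero[of x]] by simp
  then show thesis using that b by blast
qed

lemma proj_bound:
  obtains b where "b > 0" "\<And>A x. finite A \<Longrightarrow> norm (proj A x) \<le> real (card A) * b * norm x"
proof -
  obtain b where b: "b > 0" "\<And>n. norm (e n) \<le> b" "\<And>n x. \<bar>f n x\<bar> \<le> b * norm x"
    using basis_bound by blast
  have "norm (proj A x) \<le> real (card A) * (b * b) * norm x" if "finite A" for A x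
  proof -
    have "norm (f n x *\<^sub>R e n) \<le> b * b * norm x" for n
      using mult_mono[OF b(3)[of n x] b(2)[of n]] b(1) by (simp add: mult_ac)
    then have "norm (proj A x) \<le> real (card A) * (b * b * norm x)"
      unfolding proj_def by (intro sum_norm_bound)
    then show ?thesis by (simp add: mult_ac)
  qed
  then show thesis using that[of "b * b"] b(1) by simp
qed

text \<open>
  The terms of the norm-convergent expansion of \<open>x\<close> tend to zero, and the basis vectors are
  bounded away from zero, so the coefficients tend to zero.
\<close>

lemma finite_large_coefficients:
  assumes "\<delta> > 0"
  shows "finite {n. \<delta> \<le> \<bar>f n x\<bar>}"
proof -
  obtain a where a: "a > 0" "\<And>n. a \<le> norm (e n)"
    using basis unfolding is_basis_def by blast
  let ?S = "\<lambda>m. \<Sum>n<m. f n x *\<^sub>R e n"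
  have "(\<lambda>m. norm (?S m - x)) \<longlonglongrightarrow> 0"
    using basis unfolding is_basis_def by blast
  then have S: "?S \<longlonglongrightarrow> x"
    by (rule LIM_zero_cancel[OF tendsto_norm_zero_cancel])
  then have "(\<lambda>m. ?S (Suc m) - ?S m) \<longlonglongrightarrow> x - x"
    by (intro tendsto_diff LIMSEQ_Suc)
  then have "(\<lambda>m. norm (f m x *\<^sub>R e m)) \<longlonglongrightarrow> 0"
    by (intro tendsto_norm_zero) simp
  then have "eventually (\<lambda>m. norm (f m x *\<^sub>R e m) < \<delta> * a) sequentially"
    by (rule order_tendstoD) (use assms a in simp)
  then have "eventually (\<lambda>m. \<not> \<delta> \<le> \<bar>f m x\<bar>) sequentially"
  proof eventually_elim
    case (elim m)
    show ?case
    proof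
      assume "\<delta> \<le> \<bar>f m x\<bar>"
      then have "\<delta> * a \<le> \<bar>f m x\<bar> * norm (e m)"
        using a assms by (intro mult_mono) (auto intro: less_imp_le)
      then show False using elim by simp
    qed
  qed
  then show ?thesis
    unfolding eventually_sequentially
    by (metis (mono_tags, lifting) finite_nat_set_iff_bounded linorder_not_le mem_Collect_eq)
qed

lemma greedy_set_threshold:
  assumes "greedy_set x A" "A \<noteq> {}"
  obtains t where "t \<ge> 0" "\<And>n. n \<in> A \<Longrightarrow> t \<le> \<bar>f n x\<bar>" "\<And>k. k \<notin> A \<Longrightarrow> \<bar>f k x\<bar> \<le> t"
proof -
  have fin: "finite A" using assms by (simp add: greedy_set_def)
  obtain n where n: "n \<in> A" "\<And>k. k \<in> A \<Longrightarrow> \<bar>f n x\<bar> \<le> \<bar>f k x\<bar>"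
    using ex_min_if_finite[of "(\<lambda>n. \<bar>f n x\<bar>) ` A"] fin assms(2)
    by (auto simp: not_less)
  show thesis
    by (rule that[of "\<bar>f n x\<bar>"]) (use n assms in \<open>auto simp: greedy_set_def\<close>)
qed

lemma greedy_set_remove_min:
  assumes "greedy_set x A" "A \<noteq> {}"
  obtains n where "n \<in> A" "greedy_set x (A - {n})" "\<And>k. k \<in> A \<Longrightarrow> \<bar>f n x\<bar> \<le> \<bar>f k x\<bar>"
proof -
  have fin: "finite A" using assms by (simp add: greedy_set_def)
  obtain n where n: "n \<in> A" "\<And>k. k \<in> A \<Longrightarrow> \<bar>f n x\<bar> \<le> \<bar>f k x\<bar>"
    using ex_min_if_finite[of "(\<lambda>n. \<bar>f n x\<bar>) ` A"] fin assms(2)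
    by (auto simp: not_less)
  show thesis
    by (rule that[OF n(1)]) (use n assms in \<open>auto simp: greedy_set_def\<close>)
qed

lemma greedy_subset:
  assumes "greedy_set x A" "k \<le> card A"
  obtains A' where "A' \<subseteq> A" "greedy_set x A'" "card A' = k"
proof -
  have "\<exists>A'\<subseteq>A. greedy_set x A' \<and> card A' = k"
    using assms
  proof (induction "card A" arbitrary: A)
    case 0
    then show ?case by auto
  next
    case (Suc N)
    show ?case
    proof (cases "k = card A")
      case False
      have "A \<noteq> {}" using Suc.hyps by auto
      then obtain n where n: "n \<in> A" "greedy_set x (A - {n})"
        by (rule greedy_set_remove_min[OF Suc.prems(1)])
      have "finite A" using Suc.prems by (simp add: greedy_set_def)
      then have "card (A - {n}) = N" using n Suc.hyps by simp
      moreover have "k \<le> N" using Suc.prems(2) Suc.hyps(2) False by linarith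
      ultimately obtain A' where "A' \<subseteq> A - {n}" "greedy_set x A'" "card A' = k"
        using Suc.hyps(1)[of "A - {n}"] n(2) by metis
      then show ?thesis by blast
    qed (use Suc.prems in auto)
  qed
  then show thesis using that by blast
qed

section \<open>Greedy sums and greedy sets\<close>

text \<open>
  Because the coefficients tend to zero, every nonempty set of indices has a first element in the
  greedy order, so the ordering can be built by repeatedly picking the first remaining index. An
  index of the support cannot be passed over forever, since only finitely many indices have a
  coefficient at least as large as its own. If the support is finite, the construction continues
  through the indices with zero coefficient in increasing order.
\<close>

lemma greedy_ordering_exists: "\<exists>\<rho>. greedy_ordering f x \<rho>"
proof -
  let ?c = "\<lambda>n. \<bar>f n x\<bar>"
  define before where "before n k \<longleftrightarrow> ?c n > ?c k \<or> (?c n = ?c k \<and> n < k)" for n k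
  have least: "\<exists>s\<in>S. \<forall>k\<in>S. k \<noteq> s \<longrightarrow> before s k" if "S \<noteq> {}" for S
  proof -
    have "\<exists>s\<in>S. \<forall>k\<in>S. ?c k \<le> ?c s"
    proof (cases "\<forall>s\<in>S. ?c s = 0")
      case False
      then obtain s where s: "s \<in> S" "?c s > 0" by auto
      let ?T = "{n \<in> S. ?c s \<le> ?c n}"
      have fin: "finite ?T"
        by (rule finite_subset[OF _ finite_large_coefficients[OF s(2)]]) auto
      have "?T \<noteq> {}" using s by auto
      then have "Max (?c ` ?T) \<in> ?c ` ?T" using fin by (intro Max_in) auto
      then obtain n where n: "n \<in> ?T" "Max (?c ` ?T) = ?c n" by blast
      have max: "?c k \<le> ?c n" if "k \<in> ?T" for k
        unfolding n(2)[symmetric] using fin that by (intro Max_ge) auto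
      then have "?c k \<le> ?c n" if "k \<in> S" for k
        using that max n(1) by (cases "?c s \<le> ?c k") auto
      then show ?thesis using n(1) by blast
    qed (use that in auto)
    then obtain s0 where s0: "s0 \<in> S" "\<And>k. k \<in> S \<Longrightarrow> ?c k \<le> ?c s0" by blast
    define s where "s = (LEAST s. s \<in> S \<and> ?c s = ?c s0)"
    have s: "s \<in> S" "?c s = ?c s0"
      using LeastI[of "\<lambda>s. s \<in> S \<and> ?c s = ?c s0" s0] s0(1) by (auto simp: s_def)
    have "before s k" if "k \<in> S" "k \<noteq> s" for k
      using Least_le[of "\<lambda>s. s \<in> S \<and> ?c s = ?c s0" k] s s0(2)[OF that(1)] that
      unfolding before_def s_def[symmetric] by linarith
    then show ?thesis using s by blast
  qed
  define pick where "pick S = (SOME s. s \<in> S \<and> (\<forall>k\<in>S. k \<noteq> s \<longrightarrow> before s k))" for S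
  have pick: "pick S \<in> S" "\<And>k. k \<in> S \<Longrightarrow> k \<noteq> pick S \<Longrightarrow> before (pick S) k" if "S \<noteq> {}" for S
    using someI_ex[of "\<lambda>s. s \<in> S \<and> (\<forall>k\<in>S. k \<noteq> s \<longrightarrow> before s k)"] least[OF that]
    unfolding pick_def by blast+
  define Rem where "Rem = rec_nat (UNIV :: nat set) (\<lambda>_ S. S - {pick S})"
  have Rem: "Rem 0 = UNIV" "\<And>n. Rem (Suc n) = Rem n - {pick (Rem n)}"
    by (simp_all add: Rem_def)
  have inf: "infinite (Rem n)" for n
    by (induction n) (simp_all add: Rem)
  then have ne: "Rem n \<noteq> {}" for n by (metis finite.emptyI)
  have anti: "Rem k \<subseteq> Rem j" if "j \<le> k" for j k
    using that by (induction rule: dec_induct) (auto simp: Rem)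
  define \<rho> where "\<rho> n = pick (Rem n)" for n
  have \<rho>_mem: "\<rho> k \<in> Rem (Suc j)" if "j < k" for j k
    using that pick(1)[OF ne, of k] anti[of "Suc j" k] by (auto simp: \<rho>_def)
  have ord: "before (\<rho> j) (\<rho> k)" if "j < k" for j k
    using \<rho>_mem[OF that] pick(2)[OF ne, of "\<rho> k" j] by (auto simp: Rem \<rho>_def[symmetric])
  have inj: "inj \<rho>"
    by (rule linorder_injI) (use ord in \<open>force simp: before_def\<close>)
  have "n \<in> range \<rho>" if "f n x \<noteq> 0" for n
  proof (rule ccontr)
    assume n: "n \<notin> range \<rho>"
    have "n \<in> Rem j" for j
      using n by (induction j) (auto simp: Rem \<rho>_def)
    then have "before (\<rho> j) n" for j
      using n pick(2)[OF ne, of n j] unfolding \<rho>_def by fastforce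
    then have "?c n \<le> ?c (\<rho> j)" for j
      unfolding before_def by (metis less_imp_le order_refl)
    then have "range \<rho> \<subseteq> {k. ?c n \<le> ?c k}"
      by auto
    moreover have "finite {k. ?c n \<le> ?c k}"
      using that by (intro finite_large_coefficients) simp
    ultimately show False
      using inj finite_subset range_inj_infinite by blast
  qed
  then have "greedy_ordering f x \<rho>"
    unfolding greedy_ordering_def using ord[unfolded before_def] by blast
  then show ?thesis by blast
qed

lemma greedy_sum_eq_proj:
  obtains A where "greedy_set x A" "card A = m" "greedy_sum e f m x = proj A x"
proof -
  define \<rho> where "\<rho> = (SOME \<rho>. greedy_ordering f x \<rho>)"
  have "greedy_ordering f x \<rho>"
    unfolding \<rho>_def by (rule someI_ex[OF greedy_ordering_exists])
  then have supp: "{n. f n x \<noteq> 0} \<subseteq> range \<rho>"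
    and ord: "\<And>j k. j < k \<Longrightarrow> \<bar>f (\<rho> j) x\<bar> > \<bar>f (\<rho> k) x\<bar> \<or>
      (\<bar>f (\<rho> j) x\<bar> = \<bar>f (\<rho> k) x\<bar> \<and> \<rho> j < \<rho> k)"
    by (auto simp: greedy_ordering_def)
  have inj: "inj \<rho>"
    by (rule linorder_injI) (use ord in force)
  then have inj_m: "inj_on \<rho> {..<m}" by (rule inj_on_subset) simp
  let ?A = "\<rho> ` {..<m}"
  have "\<bar>f k x\<bar> \<le> \<bar>f (\<rho> j) x\<bar>" if "j < m" "k \<notin> ?A" for j k
  proof (cases "f k x = 0")
    case False
    then obtain i where i: "k = \<rho> i" using supp by auto
    then have "j < i" using that by force
    then show ?thesis using ord[of j i] i by auto
  qed simp
  then have "greedy_set x ?A" by (auto simp: greedy_set_def)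
  moreover have "card ?A = m" using inj_m by (simp add: card_image)
  moreover have "greedy_sum e f m x = proj ?A x"
    unfolding greedy_sum_def Let_def \<rho>_def[symmetric] proj_def
    using inj_m by (simp add: sum.reindex)
  ultimately show thesis using that by blast
qed

text \<open>
  Strict inequalities make \<open>A\<close> the only greedy set of its size, so neither the rule for ties nor the
  choice of a greedy ordering matters.
\<close>

lemma greedy_sum_strict:
  assumes "finite A" "\<And>n k. n \<in> A \<Longrightarrow> k \<notin> A \<Longrightarrow> \<bar>f k x\<bar> < \<bar>f n x\<bar>"
  shows "greedy_sum e f (card A) x = proj A x"
proof -
  obtain A' where A': "greedy_set x A'" "card A' = card A"
      "greedy_sum e f (card A) x = proj A' x"
    using greedy_sum_eq_proj by blast
  have fin: "finite A'" using A'(1) by (simp add: greedy_set_def)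
  have "A' = A"
  proof (rule ccontr)
    assume ne: "A' \<noteq> A"
    then obtain n where n: "n \<in> A" "n \<notin> A'"
      using card_subset_eq[OF fin, of A] A'(2) by force
    moreover obtain k where "k \<in> A'" "k \<notin> A"
      using card_subset_eq[OF assms(1), of A'] A'(2) ne by force
    ultimately show False
      using A'(1) assms(2)[of n k] by (force simp: greedy_set_def)
  qed
  then show ?thesis using A'(3) by simp
qed

text \<open>
  Pushing the coefficients on \<open>A\<close> away from zero by \<open>1 / (i + 1)\<close> makes
  \<open>A\<close> the only greedy set of its size, so the assumed bound speaks about \<open>A\<close>; then
  \<open>i\<close> tends to infinity. In the applications \<open>h x\<close> is the error of one fixed
  competitor from the infimum that defines the approximation error.
\<close>

lemma greedy_set_bound_of_greedy_sum_bound: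
  assumes bound: "\<And>x. norm (x - greedy_sum e f N x) \<le> C * norm (h x)"
    and cont: "continuous_on UNIV h"
    and A: "greedy_set x A" "card A = N"
  shows "norm (x - proj A x) \<le> C * norm (h x)"
proof -
  have fin: "finite A" using A by (simp add: greedy_set_def)
  define s where "s n = (if f n x \<ge> 0 then 1 else -1 :: real)" for n
  define v where "v = (\<Sum>n\<in>A. s n *\<^sub>R e n)"
  define y where "y i = x + inverse (real (Suc i)) *\<^sub>R v" for i
  have y_lim: "y \<longlonglongrightarrow> x"
  proof -
    have "y \<longlonglongrightarrow> x + 0 *\<^sub>R v"
      unfolding y_def by (intro tendsto_intros LIMSEQ_inverse_real_of_nat)
    then show ?thesis by simp
  qed
  have strict: "norm (y i - proj A (y i)) \<le> C * norm (h (y i))" for i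
  proof -
    define d where "d = inverse (real (Suc i))"
    have d: "d > 0" by (simp add: d_def)
    have coeff: "f n (y i) = f n x + (if n \<in> A then d * s n else 0)" for n
      unfolding y_def v_def blinfun.add_right blinfun.scaleR_right f_combination[OF fin]
        d_def[symmetric] by simp
    have "\<bar>f n (y i)\<bar> = \<bar>f n x\<bar> + d" if "n \<in> A" for n
      using that d unfolding coeff s_def by auto
    moreover have "f k (y i) = f k x" if "k \<notin> A" for k
      using that by (simp add: coeff)
    ultimately have "\<bar>f k (y i)\<bar> < \<bar>f n (y i)\<bar>" if "n \<in> A" "k \<notin> A" for n k
      using that d A(1) unfolding greedy_set_def by (smt (verit))
    then have "greedy_sum e f N (y i) = proj A (y i)"
      using greedy_sum_strict[OF fin] A(2) by blast
    then show ?thesis using bound[of "y i"] by simp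
  qed
  have "(\<lambda>i. y i - proj A (y i)) \<longlonglongrightarrow> x - proj A x"
    unfolding proj_def by (intro tendsto_intros y_lim)
  then have l: "(\<lambda>i. norm (y i - proj A (y i))) \<longlonglongrightarrow> norm (x - proj A x)"
    by (rule tendsto_norm)
  have "(\<lambda>i. h (y i)) \<longlonglongrightarrow> h x"
    using continuous_on_tendsto_compose[OF cont y_lim] by simp
  then have r: "(\<lambda>i. C * norm (h (y i))) \<longlonglongrightarrow> C * norm (h x)"
    by (intro tendsto_intros)
  show ?thesis
    by (rule LIMSEQ_le[OF l r]) (use strict in blast)
qed

section \<open>Quasi-greedy and superdemocratic bases\<close>

lemma signed_indicator_sum_eq_proj:
  assumes "finite A" "A' \<subseteq> A"
  shows "proj A' (signed_indicator_sum e \<epsilon> A) = signed_indicator_sum e \<epsilon> A'"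
  unfolding signed_indicator_sum_def
  using assms finite_subset[OF assms(2,1)] by (simp add: proj_combination Int_absorb2)

lemma quasi_greedy_proj:
  assumes "quasi_greedy_with K" "greedy_set x A"
  shows "norm (proj A x) \<le> (1 + K) * norm x"
proof -
  have "norm (x - proj A x) \<le> K * norm x"
    using assms by (simp add: quasi_greedy_with_def)
  moreover have "norm (proj A x) \<le> norm x + norm (x - proj A x)"
    using norm_triangle_ineq4[of x "x - proj A x"] by simp
  ultimately show ?thesis by (simp add: algebra_simps)
qed

text \<open>
  All coefficients of a signed sum over \<open>A\<close> are one in modulus on \<open>A\<close> and zero elsewhere, so
  every subset of \<open>A\<close> is a greedy set of it.
\<close>

lemma signed_indicator_sum_subset:
  assumes "quasi_greedy_with K" "finite A" "A' \<subseteq> A" "\<forall>n. \<bar>\<epsilon> n\<bar> = 1"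
  shows "norm (signed_indicator_sum e \<epsilon> A') \<le> (1 + K) * norm (signed_indicator_sum e \<epsilon> A)"
proof -
  have "greedy_set (signed_indicator_sum e \<epsilon> A) A'"
    using assms finite_subset[OF assms(3,2)]
    by (auto simp: greedy_set_def signed_indicator_sum_def f_combination)
  then show ?thesis
    using quasi_greedy_proj[OF assms(1)] signed_indicator_sum_eq_proj[OF assms(2,3)] by metis
qed

text \<open>
  A change of signs is the difference of the restrictions to the indices where the signs agree and
  to those where they differ.
\<close>

lemma signed_indicator_sum_change_signs:
  assumes "quasi_greedy_with K" "finite A" "\<forall>n. \<bar>\<epsilon> n\<bar> = 1" "\<forall>n. \<bar>\<eta> n\<bar> = 1"
  shows "norm (signed_indicator_sum e \<eta> A) \<le> 2 * (1 + K) * norm (signed_indicator_sum e \<epsilon> A)"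
proof -
  let ?P = "{n \<in> A. \<eta> n = \<epsilon> n}" and ?N = "{n \<in> A. \<eta> n \<noteq> \<epsilon> n}"
  let ?s = "signed_indicator_sum e"
  have neg: "\<eta> n = - \<epsilon> n" if "\<eta> n \<noteq> \<epsilon> n" for n
    using that assms(3,4) by (metis abs_eq_iff)
  have "?s \<eta> A = ?s \<eta> ?P + ?s \<eta> ?N"
    unfolding signed_indicator_sum_def
    by (subst sum.union_disjoint[symmetric]) (use assms(2) in \<open>auto intro: sum.cong\<close>)
  also have "?s \<eta> ?P = ?s \<epsilon> ?P"
    by (simp add: signed_indicator_sum_def)
  also have "?s \<eta> ?N = - ?s \<epsilon> ?N"
    unfolding signed_indicator_sum_def sum_negf[symmetric]
    by (rule sum.cong[OF refl]) (use neg in \<open>simp add: scaleR_minus_left[symmetric] del: scaleR_minus_left\<close>)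
  finally have "norm (?s \<eta> A) \<le> norm (?s \<epsilon> ?P) + norm (?s \<epsilon> ?N)"
    by (simp add: norm_triangle_ineq4)
  also have "\<dots> \<le> (1 + K) * norm (?s \<epsilon> A) + (1 + K) * norm (?s \<epsilon> A)"
    using assms by (intro add_mono signed_indicator_sum_subset) auto
  finally show ?thesis by (simp add: algebra_simps)
qed

text \<open>
  A form of Abel summation: removing indices of smallest coefficient one at a time passes only
  through greedy sets of \<open>z\<close>, whose projections are uniformly bounded. The induction needs
  the stronger claim that \<open>1\<^bsub>\<epsilon>G\<^esub>\<close> is within \<open>(1 + K) \<parallel>z\<parallel> / s\<close> of
  \<open>P\<^sub>G z / s\<close> for every \<open>s\<close> below the coefficients on \<open>G\<close>. In that form the
  errors telescope: passing from threshold \<open>u\<close> to \<open>s\<close> costs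
  \<open>(1/s - 1/u) (1 + K) \<parallel>z\<parallel>\<close>.
\<close>

lemma truncation_bound:
  assumes qg: "quasi_greedy_with K" and G: "greedy_set z G"
    and t: "t > 0" "\<And>n. n \<in> G \<Longrightarrow> t \<le> \<bar>f n z\<bar>"
    and \<epsilon>: "\<And>n. \<epsilon> n = (if f n z \<ge> 0 then 1 else -1)"
  shows "t * norm (signed_indicator_sum e \<epsilon> G) \<le> 2 * (1 + K) * norm z"
proof -
  let ?M = "(1 + K) * norm z" and ?s = "signed_indicator_sum e \<epsilon>"
  have main: "norm (?s G - (1 / s) *\<^sub>R proj G z) \<le> (1 / s) * ?M"
    if "greedy_set z G" "s > 0" "\<And>n. n \<in> G \<Longrightarrow> s \<le> \<bar>f n z\<bar>" for s G
    using that
  proof (induction "card G" arbitrary: G s)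
    case 0
    then have "G = {}" by (simp add: greedy_set_def)
    then show ?case
      using quasi_greedy_proj[OF qg 0(2)] 0(3) by (simp add: signed_indicator_sum_def)
  next
    case (Suc N)
    then have fin: "finite G" and "G \<noteq> {}" by (auto simp: greedy_set_def)
    then obtain n where n: "n \<in> G" "greedy_set z (G - {n})" "\<And>k. k \<in> G \<Longrightarrow> \<bar>f n z\<bar> \<le> \<bar>f k z\<bar>"
      using greedy_set_remove_min[OF Suc.prems(1)] by metis
    let ?G = "G - {n}" and ?u = "\<bar>f n z\<bar>"
    have u: "s \<le> ?u" "?u > 0" using Suc.prems n by force+
    have IH: "norm (?s ?G - (1 / ?u) *\<^sub>R proj ?G z) \<le> (1 / ?u) * ?M"
    proof (rule Suc.hyps(1)[OF _ n(2) u(2)])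
      show "N = card ?G" using Suc.hyps(2) n(1) fin by simp
    qed (use n(3) in blast)
    have "?s G = ?s ?G + \<epsilon> n *\<^sub>R e n"
      unfolding signed_indicator_sum_def using fin n(1) by (simp add: sum.remove add.commute)
    also have "\<epsilon> n *\<^sub>R e n = (1 / ?u) *\<^sub>R (f n z *\<^sub>R e n)"
      using u(2) by (auto simp: \<epsilon> abs_if)
    finally have sG: "?s G = ?s ?G + (1 / ?u) *\<^sub>R (f n z *\<^sub>R e n)" .
    have pG: "proj G z = proj ?G z + f n z *\<^sub>R e n"
      unfolding proj_def using fin n(1) by (simp add: sum.remove add.commute)
    have "?s G - (1 / s) *\<^sub>R proj G z =
        (?s ?G - (1 / ?u) *\<^sub>R proj ?G z) - (1 / s - 1 / ?u) *\<^sub>R proj G z"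
      unfolding sG pG by (simp add: algebra_simps)
    also have "norm \<dots> \<le> (1 / ?u) * ?M + (1 / s - 1 / ?u) * ?M"
    proof -
      have "1 / s - 1 / ?u \<ge> 0" using u Suc.prems(2) by (simp add: frac_le)
      then have "norm ((1 / s - 1 / ?u) *\<^sub>R proj G z) \<le> (1 / s - 1 / ?u) * ?M"
        using quasi_greedy_proj[OF qg Suc.prems(1)] by (simp add: mult_left_mono)
      then show ?thesis
        using IH norm_triangle_ineq4 add_mono order_trans by blast
    qed
    finally show ?case by (simp add: algebra_simps)
  qed
  have "norm (?s G) \<le> norm (?s G - (1 / t) *\<^sub>R proj G z) + norm ((1 / t) *\<^sub>R proj G z)"
    using norm_triangle_ineq[of "?s G - (1 / t) *\<^sub>R proj G z" "(1 / t) *\<^sub>R proj G z"] by simp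
  also have "\<dots> \<le> (1 / t) * ?M + (1 / t) * ?M"
    using main[OF G t] quasi_greedy_proj[OF qg G] t(1)
    by (intro add_mono) (auto simp: divide_right_mono)
  also have "\<dots> = (2 * (1 + K) * norm z) / t" by (simp add: field_simps)
  finally show ?thesis using t(1) by (simp add: pos_le_divide_eq mult.commute)
qed

text \<open>
  A norm is convex and a cube is the convex hull of its vertices. The vector \<open>v\<close>
  collects the coordinates that have already been moved to a vertex during the induction.
\<close>

lemma norm_combination_le_signs:
  assumes "finite E" "\<And>n. n \<in> E \<Longrightarrow> \<bar>a n\<bar> \<le> 1"
    and "\<And>\<eta>. \<forall>n. \<bar>\<eta> n\<bar> = 1 \<Longrightarrow> norm (v + signed_indicator_sum e \<eta> E) \<le> M"
  shows "norm (v + (\<Sum>n\<in>E. a n *\<^sub>R e n)) \<le> M"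
  using assms
proof (induction E arbitrary: v rule: finite_induct)
  case empty
  show ?case using empty(2)[of "\<lambda>_. 1"] by (simp add: signed_indicator_sum_def)
next
  case (insert m E)
  let ?w = "\<Sum>n\<in>E. a n *\<^sub>R e n" and ?\<theta> = "(1 + a m) / 2"
  have end_point: "norm ((v + c *\<^sub>R e m) + ?w) \<le> M" if c: "\<bar>c\<bar> = 1" for c
  proof (rule insert.IH)
    fix \<eta> :: "nat \<Rightarrow> real" assume \<eta>: "\<forall>n. \<bar>\<eta> n\<bar> = 1"
    have "signed_indicator_sum e (\<eta>(m := c)) (insert m E) = c *\<^sub>R e m + signed_indicator_sum e \<eta> E"
      unfolding signed_indicator_sum_def using insert.hyps
      by (simp, intro sum.cong) auto
    then show "norm ((v + c *\<^sub>R e m) + signed_indicator_sum e \<eta> E) \<le> M"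
      using insert.prems(2)[of "\<eta>(m := c)"] \<eta> c by (simp add: add.assoc del: fun_upd_apply) (simp add: fun_upd_def)
  qed (use insert.prems in auto)
  have \<theta>: "0 \<le> ?\<theta>" "?\<theta> \<le> 1" using insert.prems(1)[of m] by auto
  have "v + (\<Sum>n\<in>insert m E. a n *\<^sub>R e n) =
      ?\<theta> *\<^sub>R (v + 1 *\<^sub>R e m + ?w) + (1 - ?\<theta>) *\<^sub>R (v + (-1) *\<^sub>R e m + ?w)"
  proof -
    have "v + (c - (1 - c)) *\<^sub>R e m + ?w =
        c *\<^sub>R (v + 1 *\<^sub>R e m + ?w) + (1 - c) *\<^sub>R (v + (-1) *\<^sub>R e m + ?w)" for c
      by (simp add: algebra_simps flip: scaleR_left_distrib)
    moreover have "?\<theta> - (1 - ?\<theta>) = a m" by (simp add: field_simps)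
    ultimately show ?thesis
      using insert.hyps by (metis (no_types, lifting) add.assoc sum.insert)
  qed
  also have "norm \<dots> \<le> ?\<theta> * M + (1 - ?\<theta>) * M"
  proof -
    have "norm (?\<theta> *\<^sub>R (v + 1 *\<^sub>R e m + ?w)) \<le> ?\<theta> * M"
      using end_point[of 1] \<theta> mult_left_mono[OF _ \<theta>(1)] by fastforce
    moreover have "norm ((1 - ?\<theta>) *\<^sub>R (v + (-1) *\<^sub>R e m + ?w)) \<le> (1 - ?\<theta>) * M"
      using mult_left_mono[OF end_point[of "-1"], of "1 - ?\<theta>"] \<theta> by simp
    ultimately show ?thesis using norm_triangle_le add_mono by blast
  qed
  finally show ?case by (simp add: algebra_simps)
qed

lemma norm_sum_split:
  fixes v :: "nat \<Rightarrow> 'a"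
  assumes "finite E" "card E \<le> k * m"
    and "\<And>D. D \<subseteq> E \<Longrightarrow> card D \<le> m \<Longrightarrow> norm (sum v D) \<le> Q"
  shows "norm (sum v E) \<le> real k * Q"
  using assms
proof (induction k arbitrary: E)
  case 0
  then show ?case by simp
next
  case (Suc k)
  obtain D where D: "D \<subseteq> E" "card D = min m (card E)"
    using obtain_subset_with_card_n[of "min m (card E)" E] by auto
  have "card (E - D) = card E - card D"
    using D Suc.prems(1) by (simp add: card_Diff_subset finite_subset)
  then have "card (E - D) \<le> k * m" using D Suc.prems(2) by auto
  then have "norm (sum v (E - D)) \<le> real k * Q"
    using Suc by (meson Diff_subset finite_Diff order_trans)
  moreover have "norm (sum v D) \<le> Q" using Suc.prems(3)[OF D(1)] D(2) by simp
  moreover have "sum v E = sum v (E - D) + sum v D"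
    using sum.subset_diff[OF D(1) Suc.prems(1)] .
  ultimately show ?case
    using norm_triangle_ineq[of "sum v (E - D)" "sum v D"] by (simp add: algebra_simps)
qed

text \<open>
  By convexity the coefficients may be replaced by \<open>\<plusminus>t\<close>. Splitting \<open>E\<close> into
  \<open>k\<close> pieces no larger than \<open>A\<close> and using superdemocracy leads to a signed sum over
  \<open>A\<close>; with the signs of \<open>z\<close> it is dominated by the sum over \<open>G\<close>, which is
  controlled by the truncation bound.
\<close>

lemma small_coefficients_bound:
  assumes qg: "quasi_greedy_with K" "K > 0" and sd: "superdemocratic_with C" "C > 0"
    and G: "greedy_set z G" "\<And>n. n \<in> G \<Longrightarrow> t \<le> \<bar>f n z\<bar>" and A: "A \<subseteq> G"
    and E: "finite E" "E \<inter> A = {}" "card E \<le> k * card A"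
    and a: "t \<ge> 0" "\<And>n. n \<in> E \<Longrightarrow> \<bar>a n\<bar> \<le> t"
  shows "norm (\<Sum>n\<in>E. a n *\<^sub>R e n) \<le> real k * (C * (2 * (1 + K) * (1 + K))) * norm z"
proof (cases "t = 0")
  case True
  then have "(\<Sum>n\<in>E. a n *\<^sub>R e n) = 0" using a by (intro sum.neutral) auto
  then show ?thesis using qg(2) sd(2) by simp
next
  case False
  then have t: "t > 0" using a by simp
  define \<epsilon> where "\<epsilon> n = (if f n z \<ge> 0 then 1 else -1 :: real)" for n
  let ?s = "signed_indicator_sum e"
  have \<epsilon>: "\<forall>n. \<bar>\<epsilon> n\<bar> = 1" by (simp add: \<epsilon>_def)
  have finG: "finite G" using G(1) by (simp add: greedy_set_def)
  have finA: "finite A" using A finG finite_subset by blast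
  have "norm (0 + (\<Sum>n\<in>E. (a n / t) *\<^sub>R e n)) \<le> real k * (C * norm (?s \<epsilon> A))"
  proof (rule norm_combination_le_signs[OF E(1)])
    show "\<bar>a n / t\<bar> \<le> 1" if "n \<in> E" for n using a(2)[OF that] t by simp
    fix \<eta> :: "nat \<Rightarrow> real" assume \<eta>: "\<forall>n. \<bar>\<eta> n\<bar> = 1"
    have "norm (sum (\<lambda>n. \<eta> n *\<^sub>R e n) E) \<le> real k * (C * norm (?s \<epsilon> A))"
    proof (rule norm_sum_split[OF E(1,3)])
      fix D assume D: "D \<subseteq> E" "card D \<le> card A"
      then have "finite D" "A \<inter> D = {}" using E finite_subset by auto
      then show "norm (sum (\<lambda>n. \<eta> n *\<^sub>R e n) D) \<le> C * norm (?s \<epsilon> A)"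
        using sd(1) D(2) finA \<epsilon> \<eta>
        unfolding superdemocratic_with_def signed_indicator_sum_def by blast
    qed
    then show "norm (0 + ?s \<eta> E) \<le> real k * (C * norm (?s \<epsilon> A))"
      by (simp add: signed_indicator_sum_def)
  qed
  moreover have "(\<Sum>n\<in>E. a n *\<^sub>R e n) = t *\<^sub>R (\<Sum>n\<in>E. (a n / t) *\<^sub>R e n)"
    using t by (simp add: scaleR_sum_right)
  ultimately have "norm (\<Sum>n\<in>E. a n *\<^sub>R e n) \<le> t * (real k * (C * norm (?s \<epsilon> A)))"
    using t by (simp add: mult_left_mono)
  also have "\<dots> \<le> t * (real k * (C * ((1 + K) * norm (?s \<epsilon> G))))"
    using signed_indicator_sum_subset[OF qg(1) finG A \<epsilon>] t sd(2)
    by (intro mult_left_mono) auto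
  also have "\<dots> = real k * (C * (1 + K)) * (t * norm (?s \<epsilon> G))" by (simp add: mult_ac)
  also have "\<dots> \<le> real k * (C * (1 + K)) * (2 * (1 + K) * norm z)"
    using truncation_bound[OF qg(1) G(1) t G(2) \<epsilon>_def] qg(2) sd(2)
    by (intro mult_left_mono) auto
  finally show ?thesis by (simp add: mult_ac)
qed

lemma greedy_set_signed_union:
  assumes "finite A" "finite B" "A \<inter> B = {}" "\<forall>n. \<bar>\<epsilon> n\<bar> = 1" "\<forall>n. \<bar>\<eta> n\<bar> = 1"
  defines "x \<equiv> signed_indicator_sum e \<epsilon> A + signed_indicator_sum e \<eta> B"
  shows "greedy_set x A" "proj A x = signed_indicator_sum e \<epsilon> A"
    "proj B x = signed_indicator_sum e \<eta> B"
proof -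
  have c: "f k x = (if k \<in> A then \<epsilon> k else 0) + (if k \<in> B then \<eta> k else 0)" for k
    unfolding x_def signed_indicator_sum_def blinfun.add_right using assms(1,2)
    by (simp add: f_combination)
  then show "greedy_set x A"
    using assms(1-5) by (auto simp: greedy_set_def)
  show "proj A x = signed_indicator_sum e \<epsilon> A" "proj B x = signed_indicator_sum e \<eta> B"
    unfolding proj_def signed_indicator_sum_def c
    by (rule sum.cong; use assms(3) in auto)+
qed

text \<open>
  Supplies indices that can be added to a competing set, to adjust its cardinality at almost no cost.
\<close>

lemma small_projection_elsewhere:
  assumes "\<delta> > 0" "finite F"
  obtains D where "finite D" "D \<inter> F = {}" "card D = r" "norm (proj D x) \<le> \<delta>"
proof -
  obtain b where b: "b > 0" "\<And>n. norm (e n) \<le> b"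
    using basis_bound by metis
  define \<eta> where "\<eta> = \<delta> / ((real r + 1) * b)"
  have \<eta>: "\<eta> > 0" using assms(1) b(1) by (simp add: \<eta>_def)
  have "infinite (- (F \<union> {n. \<eta> \<le> \<bar>f n x\<bar>}))"
    using assms(2) finite_large_coefficients[OF \<eta>] by (simp add: Compl_eq_Diff_UNIV)
  then obtain D where D: "finite D" "card D = r" "D \<subseteq> - (F \<union> {n. \<eta> \<le> \<bar>f n x\<bar>})"
    using infinite_arbitrarily_large by metis
  have "norm (f n x *\<^sub>R e n) \<le> \<eta> * b" if "n \<in> D" for n
  proof -
    have "\<bar>f n x\<bar> \<le> \<eta>" using D(3) that by auto
    then show ?thesis using b mult_mono[of "\<bar>f n x\<bar>" \<eta> "norm (e n)" b] \<eta> by simp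
  qed
  then have "norm (proj D x) \<le> real r * (\<eta> * b)"
    unfolding proj_def D(2)[symmetric] by (rule sum_norm_bound)
  also have "\<dots> = \<delta> * (real r / (real r + 1))" using b(1) by (simp add: \<eta>_def)
  also have "\<dots> \<le> \<delta> * 1"
    using assms(1) by (intro mult_left_mono) auto
  finally show thesis using that[of D] D by auto
qed

section \<open>Almost-greedy bases\<close>

lemma le_mult_Inf:
  fixes C :: real
  assumes "C > 0" "S \<noteq> {}" "\<And>s. s \<in> S \<Longrightarrow> v \<le> C * s"
  shows "v \<le> C * Inf S"
proof -
  have "v / C \<le> Inf S"
    using assms by (intro cInf_greatest) (auto simp: field_simps)
  then show ?thesis using assms(1) by (simp add: field_simps)
qed

lemma le_mult_of_le_mult_Inf:
  fixes C :: real and S :: "real set"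
  assumes "C > 0" "s \<in> S" "\<And>s. s \<in> S \<Longrightarrow> 0 \<le> s" "v \<le> C * Inf S"
  shows "v \<le> C * s"
proof -
  have "Inf S \<le> s" using assms by (intro cInf_lower bdd_belowI[of _ 0]) auto
  then have "C * Inf S \<le> C * s" using assms(1) by simp
  then show ?thesis using assms(4) by simp
qed

text \<open>
  The key is that a greedy set of \<open>x\<close> may be compared with any competitor of at most its size,
  not only of equal size: a smaller competitor is padded with indices where \<open>x\<close> is
  negligible. The empty competitor gives quasi-greediness.
\<close>

lemma almost_greedy_imp_quasi_greedy_superdemocratic:
  assumes "almost_greedy e f"
  obtains C where "C > 0" "quasi_greedy_with C" "superdemocratic_with C"
proof -
  obtain C0 where C0: "C0 > 0"
      "\<And>x m. m \<ge> 1 \<Longrightarrow> norm (x - greedy_sum e f m x) \<le> C0 * sigma_tilde e f m x"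
    using assms unfolding almost_greedy_def by blast
  define C where "C = max C0 1"
  have C: "C > 0" "C0 \<le> C" "1 \<le> C" by (auto simp: C_def)
  have equal_size: "norm (x - proj A x) \<le> C0 * norm (x - proj B x)"
    if "greedy_set x A" "A \<noteq> {}" "finite B" "card B = card A" for x A B
  proof (rule greedy_set_bound_of_greedy_sum_bound[OF _ _ that(1) refl])
    have "finite A" using that(1) by (simp add: greedy_set_def)
    then have m: "card A \<ge> 1" using that(2) by (simp add: Suc_le_eq card_gt_0_iff)
    show "norm (x - greedy_sum e f (card A) x) \<le> C0 * norm (x - proj B x)" for x
      by (rule le_mult_of_le_mult_Inf[OF C0(1) _ _ C0(2)[OF m, of x, unfolded sigma_tilde_def]])
        (use that in \<open>auto simp: proj_def\<close>)
    show "continuous_on UNIV (\<lambda>x. x - proj B x)"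
      unfolding proj_def by (intro continuous_intros)
  qed
  have smaller: "norm (x - proj A x) \<le> C * norm (x - proj B x)"
    if A: "greedy_set x A" and B: "finite B" "card B \<le> card A" for x A B
  proof (cases "A = {}")
    case True
    then show ?thesis using B C(3) mult_right_mono[OF C(3), of "norm x"] by simp
  next
    case False
    show ?thesis
    proof (rule field_le_epsilon)
      fix \<delta> :: real assume "\<delta> > 0"
      then have "\<delta> / C > 0" using C by simp
      then obtain D where D: "finite D" "D \<inter> B = {}" "card D = card A - card B"
          "norm (proj D x) \<le> \<delta> / C"
        using small_projection_elsewhere[OF _ B(1)] by metis
      have "card (B \<union> D) = card A" using B D by (simp add: card_Un_disjoint Int_commute)
      then have "norm (x - proj A x) \<le> C0 * norm (x - proj (B \<union> D) x)"
        using equal_size[OF A False] B D by simp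
      also have "\<dots> \<le> C * norm (x - proj (B \<union> D) x)"
        using C by (intro mult_right_mono) auto
      also have "x - proj (B \<union> D) x = (x - proj B x) - proj D x"
        using proj_Un[OF B(1) D(1)] D(2) by (simp add: Int_commute)
      also have "C * norm \<dots> \<le> C * (norm (x - proj B x) + \<delta> / C)"
        using C D(4) norm_triangle_ineq4[of "x - proj B x" "proj D x"]
        by (intro mult_left_mono) auto
      finally show "norm (x - proj A x) \<le> C * norm (x - proj B x) + \<delta>"
        using C by (simp add: distrib_left)
    qed
  qed
  have "quasi_greedy_with C"
    unfolding quasi_greedy_with_def using smaller[of _ _ "{}"] by simp
  moreover have "superdemocratic_with C"
    unfolding superdemocratic_with_def
  proof (intro allI impI, elim conjE)
    fix A B :: "nat set" and \<epsilon> \<eta> :: "nat \<Rightarrow> real"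
    assume *: "finite A" "finite B" "A \<inter> B = {}" "card B \<le> card A"
      "\<forall>n. \<bar>\<epsilon> n\<bar> = 1" "\<forall>n. \<bar>\<eta> n\<bar> = 1"
    let ?x = "signed_indicator_sum e \<epsilon> A + signed_indicator_sum e \<eta> B"
    show "norm (signed_indicator_sum e \<eta> B) \<le> C * norm (signed_indicator_sum e \<epsilon> A)"
      using smaller[of ?x A B] greedy_set_signed_union[OF *(1-3,5,6)] * by simp
  qed
  ultimately show thesis using that C(1) by blast
qed

text \<open>
  With \<open>y = x - P\<^sub>B x\<close>, the set \<open>A - B\<close> is greedy for \<open>y\<close> and
  \<open>x - P\<^sub>A x\<close> is the greedy remainder of \<open>y\<close> plus the part of \<open>x\<close> on
  \<open>B - A\<close>, whose coefficients do not exceed those of \<open>y\<close> on the equally large set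
  \<open>A - B\<close>.
\<close>

lemma quasi_greedy_superdemocratic_imp_almost_greedy:
  assumes qg: "quasi_greedy_with K" "K > 0" and sd: "superdemocratic_with C" "C > 0"
  shows "almost_greedy e f"
proof -
  define M where "M = K + C * (2 * (1 + K) * (1 + K))"
  have M: "M > 0" using qg sd unfolding M_def by (intro add_pos_pos mult_pos_pos) auto
  have main: "norm (x - proj A x) \<le> M * norm (x - proj B x)"
    if A: "greedy_set x A" "A \<noteq> {}" and B: "finite B" "card B = card A" for x A B
  proof -
    have fin: "finite A" using A by (simp add: greedy_set_def)
    obtain t where t: "t \<ge> 0" "\<And>n. n \<in> A \<Longrightarrow> t \<le> \<bar>f n x\<bar>" "\<And>k. k \<notin> A \<Longrightarrow> \<bar>f k x\<bar> \<le> t"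
      by (rule greedy_set_threshold[OF A]) blast
    define y where "y = x - proj B x"
    have y: "f n y = (if n \<in> B then 0 else f n x)" for n
      unfolding y_def blinfun.diff_right f_proj[OF B(1)] by simp
    let ?G = "A - B" and ?E = "B - A"
    have G: "greedy_set y ?G"
      unfolding greedy_set_def
    proof (intro conjI ballI allI impI)
      fix n k assume n: "n \<in> ?G" and k: "k \<notin> ?G"
      have "\<bar>f k y\<bar> \<le> t" using k t(1) t(3)[of k] by (auto simp: y)
      also have "t \<le> \<bar>f n y\<bar>" using n t(2)[of n] by (simp add: y)
      finally show "\<bar>f k y\<bar> \<le> \<bar>f n y\<bar>" .
    qed (use fin in simp)
    have "card ?E = card ?G"
      using card_Diff_subset_Int[of B A] card_Diff_subset_Int[of A B] fin B
      by (simp add: Int_commute)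
    then have "norm (\<Sum>n\<in>?E. f n x *\<^sub>R e n) \<le> real 1 * (C * (2 * (1 + K) * (1 + K))) * norm y"
      using fin B t by (intro small_coefficients_bound[OF qg sd G, of t ?G]) (auto simp: y)
    moreover have "norm (y - proj ?G y) \<le> K * norm y"
      using qg(1) G by (simp add: quasi_greedy_with_def)
    moreover have "x - proj A x = (y - proj ?G y) + (\<Sum>n\<in>?E. f n x *\<^sub>R e n)"
    proof -
      have "proj ?G y = proj ?G x"
        unfolding proj_def by (rule sum.cong) (auto simp: y)
      moreover have "proj (A \<union> B) x = proj A x + proj ?E x" "proj (A \<union> B) x = proj B x + proj ?G x"
        using proj_Un[of A ?E x] proj_Un[of B ?G x] fin B by (auto simp: Un_commute)
      ultimately show ?thesis
        unfolding y_def proj_def[of ?E, symmetric] by (simp add: algebra_simps)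
    qed
    ultimately show ?thesis
      using norm_triangle_ineq[of "y - proj ?G y" "\<Sum>n\<in>?E. f n x *\<^sub>R e n"]
      unfolding M_def y_def[symmetric] by (simp only: distrib_right of_nat_1 mult_1)
  qed
  have "norm (x - greedy_sum e f m x) \<le> M * sigma_tilde e f m x" if m: "m \<ge> 1" for x m
  proof -
    obtain A where A: "greedy_set x A" "card A = m" "greedy_sum e f m x = proj A x"
      using greedy_sum_eq_proj by blast
    have ne: "A \<noteq> {}" using A(2) m by auto
    show ?thesis
      unfolding sigma_tilde_def A(3) proj_def[symmetric]
    proof (rule le_mult_Inf[OF M])
      show "{norm (x - proj B x) | B. finite B \<and> card B = m} \<noteq> {}"
        using card_lessThan[of m] by blast
      show "norm (x - proj A x) \<le> M * s"
        if "s \<in> {norm (x - proj B x) | B. finite B \<and> card B = m}" for s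
        using that main[OF A(1) ne] A(2) by auto
    qed
  qed
  then show ?thesis unfolding almost_greedy_def using M by blast
qed

section \<open>Approximation with fewer terms than the greedy sum\<close>

text \<open>
  Unlike in the comparison with projections of \<open>x\<close>, the coefficients of \<open>z = x - y\<close>
  on \<open>B\<close> are arbitrary. The greedy set \<open>G\<close> of \<open>z\<close> is therefore cut out by the
  threshold of \<open>A\<close>: it contains \<open>A - B\<close> and those indices of \<open>A \<union> B\<close> where
  \<open>z\<close> is large. The leftover \<open>B - G\<close> can be as large as \<open>m\<close>, which is where
  the surplus of \<open>[\<lambda>m]\<close> over \<open>m\<close> enters.
\<close>

lemma quasi_greedy_superdemocratic_bound:
  assumes qg: "quasi_greedy_with K" "K > 0" and sd: "superdemocratic_with C" "C > 0"
    and lam: "lam > 1"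
  obtains M where "M > 0"
    "\<And>x A B a m. \<lbrakk>m \<ge> 1; greedy_set x A; card A = nat \<lfloor>lam * real m\<rfloor>; finite B; card B = m\<rbrakk>
       \<Longrightarrow> norm (x - proj A x) \<le> M * norm (x - (\<Sum>n\<in>B. a n *\<^sub>R e n))"
proof -
  obtain b where b: "b > 0" "\<And>A x. finite A \<Longrightarrow> norm (proj A x) \<le> real (card A) * b * norm x"
    using proj_bound by blast
  define k where "k = nat \<lceil>2 / (lam - 1)\<rceil>"
  define Q where "Q = real k * (C * (2 * (1 + K) * (1 + K)))"
  define M where "M = (1 + b / (lam - 1)) + (K + 2 * Q)"
  have Q: "Q \<ge> 0" using qg sd by (simp add: Q_def)
  have M0: "b / (lam - 1) > 0" using b(1) lam by simp
  have M: "M > 0" using M0 Q qg(2) by (simp add: M_def)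
  have "norm (x - proj A x) \<le> M * norm (x - (\<Sum>n\<in>B. a n *\<^sub>R e n))"
    if m: "m \<ge> 1" and A: "greedy_set x A" "card A = nat \<lfloor>lam * real m\<rfloor>"
      and B: "finite B" "card B = m" for x A B a m
  proof -
    have fin: "finite A" using A by (simp add: greedy_set_def)
    define y where "y = (\<Sum>n\<in>B. a n *\<^sub>R e n)"
    define z where "z = x - y"
    have card_A: "real (card A) > lam * real m - 1" "m \<le> card A"
    proof -
      have "lam * real m \<ge> real m" using mult_right_mono[of 1 lam "real m"] lam by simp
      then have "\<lfloor>lam * real m\<rfloor> \<ge> int m" by linarith
      then show "m \<le> card A" "real (card A) > lam * real m - 1"
        using A(2) by linarith+
    qed
    have "proj (A \<union> B) y = y"
      unfolding y_def using fin B by (subst proj_combination) (auto simp: Int_absorb1)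
    then have outside: "x - proj (A \<union> B) x = z - proj (A \<union> B) z"
      unfolding z_def proj_diff by simp
    have z: "f n z = f n x" if "n \<notin> B" for n
      unfolding z_def y_def blinfun.diff_right f_combination[OF B(1)] using that by simp
    show ?thesis
    proof (cases "A \<subseteq> B")
      case True
      \<comment> \<open>Then \<open>[\<lambda>m] = m\<close>, so \<open>m\<close> is bounded and crude estimates suffice.\<close>
      then have AB: "A = B" using card_seteq[OF B(1)] card_A B(2) by blast
      then have "real m * (lam - 1) < 1"
        using card_A(1) B(2) by (simp add: algebra_simps)
      then have "real m \<le> 1 / (lam - 1)" using lam by (simp add: field_simps)
      then have "real m * b * norm z \<le> 1 / (lam - 1) * b * norm z"
        using b(1) by (intro mult_right_mono) auto
      then have "norm (proj A z) \<le> b / (lam - 1) * norm z"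
        using b(2)[OF fin, of z] AB B(2) by simp
      moreover have "x - proj A x = z - proj A z" using outside AB by simp
      ultimately have "norm (x - proj A x) \<le> (1 + b / (lam - 1)) * norm z"
        using norm_triangle_ineq4[of z "proj A z"] by (simp only: distrib_right mult_1)
      also have "\<dots> \<le> M * norm z"
        using Q qg(2) by (intro mult_right_mono) (auto simp: M_def)
      finally show ?thesis by (simp add: z_def y_def)
    next
      case False
      have "A \<noteq> {}" using False by auto
      then obtain t where t: "t \<ge> 0" "\<And>n. n \<in> A \<Longrightarrow> t \<le> \<bar>f n x\<bar>" "\<And>k. k \<notin> A \<Longrightarrow> \<bar>f k x\<bar> \<le> t"
        by (rule greedy_set_threshold[OF A(1)]) blast
      define G where "G = {n \<in> A \<union> B. t \<le> \<bar>f n z\<bar>}"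
      have G: "greedy_set z G"
        unfolding greedy_set_def
      proof (intro conjI ballI allI impI)
        show "finite G" using fin B by (simp add: G_def)
        fix n k assume n: "n \<in> G" and k: "k \<notin> G"
        have "\<bar>f k z\<bar> \<le> t"
          using k t(3)[of k] z[of k] by (cases "k \<in> A \<union> B") (auto simp: G_def)
        then show "\<bar>f k z\<bar> \<le> \<bar>f n z\<bar>" using n by (simp add: G_def)
      qed
      have AG: "A - B \<subseteq> G" using t(2) z by (auto simp: G_def)
      \<comment> \<open>The integer part costs at most one index; as \<open>A - B\<close> is nonempty, that loss is
        absorbed by doubling the constant.\<close>
      have m_le: "m \<le> k * card (A - B)"
      proof -
        let ?c = "card (A - B)"
        have "card A - card B \<le> ?c" by (rule diff_card_le_card_Diff[OF B(1)])
        then have "real ?c > (lam - 1) * real m - 1"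
          using card_A B(2) by (simp add: algebra_simps)
        moreover have "?c \<ge> 1"
          using False fin by (simp add: Suc_le_eq card_gt_0_iff)
        ultimately have "(lam - 1) * real m \<le> 2 * real ?c" by linarith
        then have "real m \<le> 2 / (lam - 1) * real ?c" using lam by (simp add: field_simps)
        also have "\<dots> \<le> real k * real ?c"
          unfolding k_def by (intro mult_right_mono real_nat_ceiling_ge) auto
        finally show ?thesis by (simp flip: of_nat_mult)
      qed
      have small: "norm (\<Sum>n\<in>E. c n *\<^sub>R e n) \<le> Q * norm z"
        if "E \<subseteq> B" "\<And>n. n \<in> E \<Longrightarrow> \<bar>c n\<bar> \<le> t" for E c
        unfolding Q_def
      proof (rule small_coefficients_bound[OF qg sd G _ AG _ _ _ t(1) that(2)])
        show "finite E" using B(1) that(1) finite_subset by blast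
        show "E \<inter> (A - B) = {}" using that(1) by auto
        show "card E \<le> k * card (A - B)"
          using card_mono[OF B(1) that(1)] B(2) m_le by simp
      qed (auto simp: G_def)
      have "norm (proj (B - G) z) \<le> Q * norm z"
        unfolding proj_def by (rule small) (auto simp: G_def)
      moreover have "norm (proj (B - A) x) \<le> Q * norm z"
        unfolding proj_def by (rule small) (auto simp: t(3))
      moreover have "norm (z - proj G z) \<le> K * norm z"
        using qg(1) G by (simp add: quasi_greedy_with_def)
      moreover have decomp: "x - proj A x = (z - proj G z) - proj (B - G) z + proj (B - A) x"
      proof -
        have "A \<union> B = G \<union> (B - G)" using AG by (auto simp: G_def)
        then have "proj (A \<union> B) z = proj G z + proj (B - G) z"
          using proj_Un[of G "B - G" z] G B(1) by (simp add: greedy_set_def)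
        moreover have "proj (A \<union> B) x = proj A x + proj (B - A) x"
          using proj_Un[of A "B - A" x] fin B(1) by simp
        ultimately show ?thesis using outside by (simp add: algebra_simps)
      qed
      ultimately have "norm (x - proj A x) \<le> K * norm z + Q * norm z + Q * norm z"
        using norm_triangle_ineq[of "(z - proj G z) - proj (B - G) z" "proj (B - A) x"]
          norm_triangle_ineq4[of "z - proj G z" "proj (B - G) z"] unfolding decomp by linarith
      also have "\<dots> = (K + 2 * Q) * norm z" by (simp add: algebra_simps)
      also have "\<dots> \<le> M * norm z"
        using M0 by (intro mult_right_mono) (auto simp: M_def)
      finally show ?thesis by (simp add: z_def y_def)
    qed
  qed
  then show thesis using that M by blast
qed

section \<open>Bounds by the error of constant-coefficient approximation\<close>

text \<open>
  For a greedy set \<open>A\<close>, take a greedy subset of size \<open>[\<lambda>m]\<close> with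
  \<open>m = [|A| / \<lambda>]\<close>: fewer than \<open>\<lambda> + 1\<close> indices are lost, and
  bounding them by the triangle inequality gives quasi-greediness.
  For superdemocracy let \<open>A'\<close> be a subset of \<open>A\<close> of size \<open>[\<lambda>m]\<close> and
  \<open>D\<close> a piece of \<open>B\<close> padded to size exactly \<open>m\<close>. The set \<open>A'\<close> is
  greedy for \<open>x = 1\<^bsub>\<epsilon>A'\<^esub> + 1\<^sub>D\<close>, and subtracting \<open>1\<^sub>D\<close> leaves
  \<open>1\<^bsub>\<epsilon>A'\<^esub>\<close>, so the hypothesis bounds \<open>1\<^sub>D\<close> by
  \<open>1\<^bsub>\<epsilon>A'\<^esub>\<close>. Boundedly many such pieces cover \<open>B\<close>, unless
  \<open>m = 0\<close>, when \<open>A\<close> and \<open>B\<close> have fewer than \<open>\<lambda>\<close> elements.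
\<close>

lemma D_err_bound_imp_quasi_greedy_superdemocratic:
  assumes lam: "lam > 0" and C: "C > 0"
    and bound: "\<And>x m. m \<ge> 1 \<Longrightarrow>
      norm (x - greedy_sum e f (nat \<lfloor>lam * real m\<rfloor>) x) \<le> C * D_err e m x"
  obtains K C' where "K > 0" "quasi_greedy_with K" "C' > 0" "superdemocratic_with C'"
proof -
  have H: "norm (x - proj A x) \<le> C * norm (x - \<alpha> *\<^sub>R indicator_sum e B)"
    if "m \<ge> 1" "greedy_set x A" "card A = nat \<lfloor>lam * real m\<rfloor>" "finite B" "card B = m"
    for x A B \<alpha> m
  proof (rule greedy_set_bound_of_greedy_sum_bound[OF _ _ that(2,3)])
    show "norm (x - greedy_sum e f (nat \<lfloor>lam * real m\<rfloor>) x)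
        \<le> C * norm (x - \<alpha> *\<^sub>R indicator_sum e B)" for x
      by (rule le_mult_of_le_mult_Inf[OF C _ _ bound[OF that(1), of x, unfolded D_err_def]])
        (use that in auto)
    show "continuous_on UNIV (\<lambda>x. x - \<alpha> *\<^sub>R indicator_sum e B)"
      by (intro continuous_intros)
  qed
  have size: "\<exists>m. nat \<lfloor>lam * real m\<rfloor> \<le> N \<and> real N < lam * real m + lam" for N
  proof (intro exI conjI)
    let ?m = "nat \<lfloor>real N / lam\<rfloor>"
    have m: "real ?m \<le> real N / lam" "real N / lam < real ?m + 1"
      using lam by (simp_all add: of_nat_nat)
    show "nat \<lfloor>lam * real ?m\<rfloor> \<le> N"
    proof -
      have "lam * real ?m \<le> real N" using m(1) lam by (simp only: pos_le_divide_eq mult.commute)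
      then show ?thesis by linarith
    qed
    show "real N < lam * real ?m + lam"
      using m(2) lam by (simp add: field_simps)
  qed
  obtain b' where b': "b' > 0"
      "\<And>A x. finite A \<Longrightarrow> norm (proj A x) \<le> real (card A) * b' * norm x"
    using proj_bound by blast
  define K where "K = (C + 1) + (lam + 1) * b'"
  have K: "K > 0" using C lam b' by (simp add: K_def add_pos_pos)
  have "norm (x - proj A x) \<le> K * norm x" if A: "greedy_set x A" for x A
  proof -
    have fin: "finite A" using A by (simp add: greedy_set_def)
    obtain m where m: "nat \<lfloor>lam * real m\<rfloor> \<le> card A" "real (card A) < lam * real m + lam"
      using size by blast
    obtain A' where A': "A' \<subseteq> A" "greedy_set x A'" "card A' = nat \<lfloor>lam * real m\<rfloor>"
      by (rule greedy_subset[OF A m(1)])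
    have fin': "finite A'" using A'(2) by (simp add: greedy_set_def)
    have "norm (x - proj A' x) \<le> (C + 1) * norm x"
    proof (cases "m = 0")
      case True
      then have "A' = {}" using A'(3) fin' by simp
      then show ?thesis using C by (simp add: algebra_simps)
    next
      case False
      then have "norm (x - proj A' x) \<le> C * norm x"
        using H[of m x A' "{..<m}" 0] A' by simp
      then show ?thesis using norm_ge_zero[of x] by (simp only: distrib_right mult_1)
    qed
    moreover have "norm (proj (A - A') x) \<le> (lam + 1) * b' * norm x"
    proof -
      have "real (card (A - A')) = real (card A) - real (card A')"
        using A'(1) fin fin' by (simp add: card_Diff_subset card_mono of_nat_diff)
      also have "\<dots> \<le> lam + 1" using m(2) A'(3) lam by linarith
      finally have "real (card (A - A')) * b' * norm x \<le> (lam + 1) * b' * norm x"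
        using b'(1) by (intro mult_right_mono) auto
      then show ?thesis using b'(2)[of "A - A'" x] fin by simp
    qed
    moreover have "x - proj A x = (x - proj A' x) - proj (A - A') x"
      using proj_Un[of A' "A - A'" x] fin fin' A'(1) by (simp add: Un_absorb1)
    ultimately show ?thesis
      using norm_triangle_ineq4[of "x - proj A' x" "proj (A - A') x"]
      unfolding K_def by (simp add: algebra_simps)
  qed
  then have qg: "quasi_greedy_with K" by (simp add: quasi_greedy_with_def)
  obtain b where b: "b > 0" "\<And>n. norm (e n) \<le> b" "\<And>n x. \<bar>f n x\<bar> \<le> b * norm x"
    using basis_bound by blast
  define k where "k = nat \<lceil>2 * lam\<rceil>"
  define R where "R = 2 * (1 + K) * ((1 + K) * (C * (1 + K)))"
  define C' where "C' = lam * b * b + real k * R"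
  have R: "R \<ge> 0" using K C by (simp add: R_def)
  have C': "C' > 0" using R lam b(1) by (simp add: C'_def add_pos_nonneg)
  have "norm (signed_indicator_sum e \<eta> B) \<le> C' * norm (signed_indicator_sum e \<epsilon> A)"
    if *: "finite A" "finite B" "A \<inter> B = {}" "card B \<le> card A"
      and \<epsilon>: "\<forall>n. \<bar>\<epsilon> n\<bar> = 1" and \<eta>: "\<forall>n. \<bar>\<eta> n\<bar> = 1" for A B \<epsilon> \<eta>
  proof -
    let ?s = "signed_indicator_sum e"
    obtain m where m: "nat \<lfloor>lam * real m\<rfloor> \<le> card A" "real (card A) < lam * real m + lam"
      using size by blast
    show ?thesis
    proof (cases "A = {}")
      case True
      then have "B = {}" using * by simp
      then show ?thesis using C' by (simp add: signed_indicator_sum_def)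
    next
      case nonempty: False
      show ?thesis
      proof (cases "m = 0")
        case True
        obtain n where "n \<in> A" using nonempty by auto
        then have "\<bar>f n (?s \<epsilon> A)\<bar> = 1"
          using \<epsilon> *(1) by (simp add: signed_indicator_sum_def f_combination)
        then have one: "1 \<le> b * norm (?s \<epsilon> A)" using b(3)[of n "?s \<epsilon> A"] by simp
        have "norm (?s \<eta> B) \<le> real (card B) * b"
          unfolding signed_indicator_sum_def using b(2) \<eta> by (intro sum_norm_bound) simp
        also have "\<dots> \<le> lam * b"
          using m(2) True *(4) b(1) by (intro mult_right_mono) auto
        also have "\<dots> \<le> lam * b * (b * norm (?s \<epsilon> A))"
          using mult_left_mono[OF one, of "lam * b"] lam b(1) by simp
        also have "\<dots> \<le> C' * norm (?s \<epsilon> A)"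
          unfolding C'_def using R by (simp add: algebra_simps)
        finally show ?thesis .
      next
        case False
        then have m1: "m \<ge> 1" by simp
        obtain A' where A': "A' \<subseteq> A" "card A' = nat \<lfloor>lam * real m\<rfloor>"
          using obtain_subset_with_card_n[OF m(1)] by metis
        have fin': "finite A'" using A'(1) *(1) finite_subset by blast
        have "norm (sum (\<lambda>n. \<eta> n *\<^sub>R e n) B) \<le> real k * (R * norm (?s \<epsilon> A))"
        proof (rule norm_sum_split[OF *(2)])
          have "real (card B) \<le> 2 * lam * real m"
          proof -
            have "lam \<le> lam * real m" using m1 lam by simp
            then show ?thesis using m(2) *(4) by linarith
          qed
          also have "\<dots> \<le> real k * real m"
            unfolding k_def by (intro mult_right_mono real_nat_ceiling_ge) auto
          finally show "card B \<le> k * m" by (simp flip: of_nat_mult)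
          fix D assume D: "D \<subseteq> B" "card D \<le> m"
          have finD: "finite D" using D(1) *(2) finite_subset by blast
          have "infinite (- (A \<union> B))" using * by (simp add: Compl_eq_Diff_UNIV)
          then obtain F where F: "finite F" "card F = m - card D" "F \<subseteq> - (A \<union> B)"
            using infinite_arbitrarily_large by metis
          let ?D = "D \<union> F" and ?one = "\<lambda>_. 1 :: real"
          have D': "finite ?D" "card ?D = m" "A' \<inter> ?D = {}"
          proof -
            have "D \<inter> F = {}" using D(1) F(3) by auto
            then show "card ?D = m" using finD F D(2) by (simp add: card_Un_disjoint)
            show "A' \<inter> ?D = {}" using D(1) F(3) A'(1) *(3) by auto
          qed (use finD F in simp)
          have one: "?s ?one ?D = indicator_sum e ?D"
            by (simp add: signed_indicator_sum_def indicator_sum_def)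
          let ?x = "?s \<epsilon> A' + ?s ?one ?D"
          have x: "greedy_set ?x A'" "proj A' ?x = ?s \<epsilon> A'"
            by (rule greedy_set_signed_union[OF fin' D'(1,3) \<epsilon>]; simp)+
          have "norm (?s ?one ?D) \<le> C * norm (?s \<epsilon> A')"
            using H[OF m1 x(1) A'(2) D'(1,2), of 1] x(2) one by simp
          also have "\<dots> \<le> C * ((1 + K) * norm (?s \<epsilon> A))"
            using signed_indicator_sum_subset[OF qg *(1) A'(1) \<epsilon>] C by simp
          finally have big: "norm (?s ?one ?D) \<le> C * ((1 + K) * norm (?s \<epsilon> A))" .
          have "norm (?s \<eta> D) \<le> 2 * (1 + K) * norm (?s ?one D)"
            using signed_indicator_sum_change_signs[OF qg finD _ \<eta>] by simp
          also have "\<dots> \<le> 2 * (1 + K) * ((1 + K) * norm (?s ?one ?D))"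
            using signed_indicator_sum_subset[OF qg D'(1), of D ?one] K
            by (intro mult_left_mono) auto
          also have "\<dots> \<le> 2 * (1 + K) * ((1 + K) * (C * ((1 + K) * norm (?s \<epsilon> A))))"
            using big K by (intro mult_left_mono) auto
          finally show "norm (sum (\<lambda>n. \<eta> n *\<^sub>R e n) D) \<le> R * norm (?s \<epsilon> A)"
            unfolding R_def signed_indicator_sum_def by (simp add: mult_ac)
        qed
        also have "\<dots> \<le> C' * norm (?s \<epsilon> A)"
          unfolding C'_def using lam b(1) by (simp add: algebra_simps)
        finally show ?thesis by (simp add: signed_indicator_sum_def)
      qed
    qed
  qed
  then have "superdemocratic_with C'"
    unfolding superdemocratic_with_def by blast
  then show thesis using that K qg C' by blast
qed

lemma D_err_bound_imp_almost_greedy: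
  assumes "lam > 0" "C > 0"
    and "\<And>x m. m \<ge> 1 \<Longrightarrow> norm (x - greedy_sum e f (nat \<lfloor>lam * real m\<rfloor>) x) \<le> C * D_err e m x"
  shows "almost_greedy e f"
  using D_err_bound_imp_quasi_greedy_superdemocratic[OF assms]
    quasi_greedy_superdemocratic_imp_almost_greedy by metis

lemma almost_greedy_imp_D_star_err_bound:
  assumes "almost_greedy e f" "lam > 1"
  shows "\<exists>C>0. \<forall>x. \<forall>m\<ge>1.
    norm (x - greedy_sum e f (nat \<lfloor>lam * real m\<rfloor>) x) \<le> C * D_star_err e m x"
proof -
  obtain K where K: "K > 0" "quasi_greedy_with K" "superdemocratic_with K"
    using almost_greedy_imp_quasi_greedy_superdemocratic[OF assms(1)] by blast
  obtain M where M: "M > 0"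
    "\<And>x A B a m. \<lbrakk>m \<ge> 1; greedy_set x A; card A = nat \<lfloor>lam * real m\<rfloor>; finite B; card B = m\<rbrakk>
       \<Longrightarrow> norm (x - proj A x) \<le> M * norm (x - (\<Sum>n\<in>B. a n *\<^sub>R e n))"
    using quasi_greedy_superdemocratic_bound[OF K(2,1,3,1) assms(2)] by blast
  have "norm (x - greedy_sum e f (nat \<lfloor>lam * real m\<rfloor>) x) \<le> M * D_star_err e m x"
    if m: "m \<ge> 1" for x m
  proof -
    obtain A where A: "greedy_set x A" "card A = nat \<lfloor>lam * real m\<rfloor>"
        "greedy_sum e f (nat \<lfloor>lam * real m\<rfloor>) x = proj A x"
      by (rule greedy_sum_eq_proj)
    show ?thesis
      unfolding A(3) D_star_err_def
    proof (rule le_mult_Inf[OF M(1)])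
      have "norm (x - 0 *\<^sub>R signed_indicator_sum e (\<lambda>_. 1) {..<m}) \<in>
          {norm (x - \<alpha> *\<^sub>R signed_indicator_sum e \<epsilon> A) | \<alpha> A \<epsilon>.
            finite A \<and> card A = m \<and> (\<forall>n. \<bar>\<epsilon> n\<bar> = 1)}"
        by (intro CollectI exI conjI) (rule refl, auto)
      then show "{norm (x - \<alpha> *\<^sub>R signed_indicator_sum e \<epsilon> A) | \<alpha> A \<epsilon>.
          finite A \<and> card A = m \<and> (\<forall>n. \<bar>\<epsilon> n\<bar> = 1)} \<noteq> {}"
        by blast
      fix s
      assume "s \<in> {norm (x - \<alpha> *\<^sub>R signed_indicator_sum e \<epsilon> A) | \<alpha> A \<epsilon>.
          finite A \<and> card A = m \<and> (\<forall>n. \<bar>\<epsilon> n\<bar> = 1)}"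
      then obtain \<alpha> B \<epsilon> where s: "s = norm (x - \<alpha> *\<^sub>R signed_indicator_sum e \<epsilon> B)"
          "finite B" "card B = m" by blast
      show "norm (x - proj A x) \<le> M * s"
        using M(2)[OF m A(1,2) s(2,3), of "\<lambda>n. \<alpha> * \<epsilon> n"]
        unfolding s(1) signed_indicator_sum_def by (simp add: scaleR_sum_right)
    qed
  qed
  then show ?thesis using M(1) by blast
qed

end

lemma D_star_err_le_D_err: "D_star_err e m x \<le> D_err e m x"
  unfolding D_star_err_def D_err_def
proof (rule cInf_superset_mono)
  show "{norm (x - \<alpha> *\<^sub>R indicator_sum e A) | \<alpha> A. finite A \<and> card A = m} \<noteq> {}"
    using card_lessThan[of m] by blast
  show "bdd_below {norm (x - \<alpha> *\<^sub>R signed_indicator_sum e \<epsilon> A) | \<alpha> A \<epsilon>.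
      finite A \<and> card A = m \<and> (\<forall>n. \<bar>\<epsilon> n\<bar> = 1)}"
    by (rule bdd_belowI[of _ 0]) auto
  show "{norm (x - \<alpha> *\<^sub>R indicator_sum e A) | \<alpha> A. finite A \<and> card A = m} \<subseteq>
      {norm (x - \<alpha> *\<^sub>R signed_indicator_sum e \<epsilon> A) | \<alpha> A \<epsilon>.
        finite A \<and> card A = m \<and> (\<forall>n. \<bar>\<epsilon> n\<bar> = 1)}"
  proof (safe, intro exI conjI)
    show "norm (x - \<alpha> *\<^sub>R indicator_sum e A) =
        norm (x - \<alpha> *\<^sub>R signed_indicator_sum e (\<lambda>_. 1) A)" for \<alpha> A
      by (simp add: signed_indicator_sum_def indicator_sum_def)
  qed auto
qed

theorem theorem4p3:
  fixes e :: "nat \<Rightarrow> 'a::banach"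
    and f :: "nat \<Rightarrow> 'a \<Rightarrow>\<^sub>L real"
    and lam :: real
  assumes "is_basis e f"
    and "lam > 1"
  shows "(almost_greedy e f \<longleftrightarrow>
            (\<exists>C>0. \<forall>x. \<forall>m\<ge>1.
               norm (x - greedy_sum e f (nat \<lfloor>lam * real m\<rfloor>) x) \<le> C * D_err e m x)) \<and>
         (almost_greedy e f \<longleftrightarrow>
            (\<exists>C>0. \<forall>x. \<forall>m\<ge>1.
               norm (x - greedy_sum e f (nat \<lfloor>lam * real m\<rfloor>) x) \<le> C * D_star_err e m x))"
proof -
  interpret schauder_basis e f using assms(1) by unfold_locales
  let ?err = "\<lambda>m x. norm (x - greedy_sum e f (nat \<lfloor>lam * real m\<rfloor>) x)"
  have star_imp: "\<exists>C>0. \<forall>x. \<forall>m\<ge>1. ?err m x \<le> C * D_err e m x"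
    if star: "\<exists>C>0. \<forall>x. \<forall>m\<ge>1. ?err m x \<le> C * D_star_err e m x"
  proof -
    obtain C where C: "C > 0" "\<And>x m. m \<ge> 1 \<Longrightarrow> ?err m x \<le> C * D_star_err e m x"
      using star by blast
    have "?err m x \<le> C * D_err e m x" if "m \<ge> 1" for m x
      using C(2)[OF that, of x] mult_left_mono[OF D_star_err_le_D_err[of e m x], of C] C(1)
      by linarith
    then show ?thesis using C(1) by blast
  qed
  have err_imp: "almost_greedy e f" if "\<exists>C>0. \<forall>x. \<forall>m\<ge>1. ?err m x \<le> C * D_err e m x"
    using that D_err_bound_imp_almost_greedy[of lam] assms(2) by (metis less_trans zero_less_one)
  show ?thesis
    using star_imp err_imp almost_greedy_imp_D_star_err_bound[OF _ assms(2)] by blast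
qed

end
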